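(* Let $I$ be a set, let $e\in I$, and let $R\subseteq (I\setminus\{e\})\times I^{2}$ be both $e$-transitive and $e$-reflexive. Let $p\in\beta I$ be an ultrafilter different from the principal ultrafilter on $e$. The following are equivalent: (i) $R^{m}(p,\cdot,\cdot)=R^{s}(p,\cdot,\cdot)$ as binary relations on $\beta I$; (ii) $p$ is a self-$R(\cdot,\cdot,e)$ ultrafilter.
   Context: $\beta X$ denotes the set of ultrafilters on $X$; elements of $X$ are identified with the corresponding principal ultrafilters. An ultrafilter $p\in\beta I$ other than the principal ultrafilter on $e$ contains $I\setminus\{e\}$ and is identified with an ultrafilter on $I\setminus\{e\}$. $R$ is $e$-transitive if for all $i,j\in I\setminus\{e\}$ and all $a,b\in I$, $R(i,j,e)$ and $R(j,a,b)$ imply $R(i,a,b)$. $R$ is $e$-reflexive if $R(i,i,e)$ holds for all $i\in I\setminus\{e\}$. Given a binary relation $S$ on $I$, an ultrafilter $p\in\beta I$ is a self-$S$ ultrafilter if $\{i\mid\{j\in I\mid S(i,j)\}\in p\}\in p$. Here $S=R(\cdot,\cdot,e)=\{(i,j)\mid R(i,j,e)\}$. Strong extension: $R^s(p,u,v)$ holds iff $\{c\mid\{a\in I\mid\{b\in I\mid R(c,a,b)\}\in v\}\in u\}\in p$. Nonstandard setting: one works in a nonstandard extension $X\mapsto{}^{*}X$ that is sufficiently saturated (e.g. $\kappa$-saturated for some $\kappa$ larger than the cardinality of the power sets of all standard sets involved, including their finite products). For an ultrafilter $u$ on $X$, its monad is $\mu(u)=\{\alpha\in{}^{*}X\mid \forall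 A\subseteq X\ (A\in u\Leftrightarrow\alpha\in{}^{*}A)\}$. The tensor product $u\otimes v$ of $u\in\beta I$, $v\in\beta J$ is the ultrafilter on $I\times J$ with $A\in u\otimes v\Leftrightarrow\{i\in I\mid\{j\in J\mid(i,j)\in A\}\in v\}\in u$. Mixed extension: $R^m(p,u,v)$ holds iff there exist $\gamma\in\mu(p)$ and $(\alpha,\beta)\in\mu(u\otimes v)$ such that ${}^{*}R(\gamma,\alpha,\beta)$. *)

theory Defs
  imports Main
begin

unbundle cardinal_syntax

section \<open>Ultrafilters\<close>

text \<open>\<open>\<beta> X\<close> is the set of ultrafilters on the set \<open>X\<close>, each given as its collection of
  members, which are subsets of \<open>X\<close>.\<close>

definition ultrafilter_on :: "'a set \<Rightarrow> 'a set set \<Rightarrow> bool" where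
  "ultrafilter_on X u \<longleftrightarrow>
     u \<subseteq> Pow X \<and> X \<in> u \<and> {} \<notin> u \<and>
     (\<forall>A\<in>u. \<forall>B\<in>u. A \<inter> B \<in> u) \<and>
     (\<forall>A\<in>u. \<forall>B. A \<subseteq> B \<and> B \<subseteq> X \<longrightarrow> B \<in> u) \<and>
     (\<forall>A. A \<subseteq> X \<longrightarrow> A \<in> u \<or> X - A \<in> u)"

definition \<beta> :: "'a set \<Rightarrow> 'a set set set" where
  "\<beta> X = {u. ultrafilter_on X u}"

definition principal_uf :: "'a set \<Rightarrow> 'a \<Rightarrow> 'a set set" where
  "principal_uf X x = {A. A \<subseteq> X \<and> x \<in> A}"

definition tensor :: "'a set \<Rightarrow> 'b set \<Rightarrow> 'a set set \<Rightarrow> 'b set set \<Rightarrow> ('a \<times> 'b) set set" where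
  "tensor I J u v = {A. A \<subseteq> I \<times> J \<and> {i\<in>I. {j\<in>J. (i, j) \<in> A} \<in> v} \<in> u}"

definition self_ultrafilter :: "'a set \<Rightarrow> ('a \<times> 'a) set \<Rightarrow> 'a set set \<Rightarrow> bool" where
  "self_ultrafilter I S p \<longleftrightarrow> {i\<in>I. {j\<in>I. (i, j) \<in> S} \<in> p} \<in> p"


section \<open>Nonstandard extensions\<close>

text \<open>
  The standard universe is a type \<open>'x\<close>, of which the sets under study are subsets (it may
  contain, besides the elements of \<open>I\<close>, any further standard objects, e.g. relations over
  \<open>I\<close>); the nonstandard universe is a type \<open>'s\<close>.  An \<open>n\<close>-ary relation over a universe is a set
  of lists of length \<open>n\<close>.  A map \<open>star\<close> from standard to nonstandard relations is a
  nonstandard extension if it satisfies the transfer principle for all first-order formulas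
  built from arbitrary standard relations.  A standard element \<open>x\<close> enters a formula through the
  relation \<open>{[x]}\<close>.  Free variables are read as universally quantified, so that no notion of
  sentence is needed.  Lists of different lengths in one argument of \<open>star\<close> do not interact,
  because each atomic formula sees lists of one length only.
\<close>

datatype 'x fm =
    Rel "'x list set" "nat list"
  | Eq nat nat
  | Neg "'x fm"
  | Conj "'x fm" "'x fm"
  | Ex nat "'x fm"

primrec holds :: "('x list set \<Rightarrow> 'u list set) \<Rightarrow> (nat \<Rightarrow> 'u) \<Rightarrow> 'x fm \<Rightarrow> bool" where
  "holds J \<nu> (Rel A is) \<longleftrightarrow> map \<nu> is \<in> J A"
| "holds J \<nu> (Eq i j) \<longleftrightarrow> \<nu> i = \<nu> j"
| "holds J \<nu> (Neg \<phi>) \<longleftrightarrow> \<not> holds J \<nu> \<phi>"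
| "holds J \<nu> (Conj \<phi> \<psi>) \<longleftrightarrow> holds J \<nu> \<phi> \<and> holds J \<nu> \<psi>"
| "holds J \<nu> (Ex i \<phi>) \<longleftrightarrow> (\<exists>x. holds J (\<nu>(i := x)) \<phi>)"

definition nonstandard_extension :: "('x list set \<Rightarrow> 's list set) \<Rightarrow> bool" where
  "nonstandard_extension star \<longleftrightarrow>
     (\<forall>\<phi>. (\<forall>\<nu>. holds (\<lambda>A. A) \<nu> \<phi>) \<longleftrightarrow> (\<forall>\<nu>. holds star \<nu> \<phi>))"

text \<open>The internal subsets of the \<open>n\<close>-th power of the nonstandard universe are the sections of
  standard relations at nonstandard parameters \<open>bs\<close>.\<close>

definition internal :: "('x list set \<Rightarrow> 's list set) \<Rightarrow> nat \<Rightarrow> 's list set \<Rightarrow> bool" where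
  "internal star n B \<longleftrightarrow> (\<exists>A bs. B = {xs. length xs = n \<and> bs @ xs \<in> star A})"

definition saturated :: "('x list set \<Rightarrow> 's list set) \<Rightarrow> 'k rel \<Rightarrow> bool" where
  "saturated star \<kappa> \<longleftrightarrow>
     (\<forall>n F. (\<forall>B\<in>F. internal star n B) \<and> |F| <o \<kappa> \<and>
            (\<forall>G. G \<subseteq> F \<and> finite G \<longrightarrow> \<Inter>G \<noteq> {}) \<longrightarrow> \<Inter>F \<noteq> {})"

definition powers_below :: "'x set \<Rightarrow> 'k rel \<Rightarrow> bool" where
  "powers_below I \<kappa> \<longleftrightarrow> (\<forall>n. |Pow {xs. set xs \<subseteq> I \<and> length xs = n}| <o \<kappa>)"

definition sufficiently_saturated_extension ::
    "('x list set \<Rightarrow> 's list set) \<Rightarrow> 'x set \<Rightarrow> 'k rel \<Rightarrow> bool" where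
  "sufficiently_saturated_extension star I \<kappa> \<longleftrightarrow>
     nonstandard_extension star \<and> Card_order \<kappa> \<and> powers_below I \<kappa> \<and> saturated star \<kappa>"

text \<open>The extensions of sets, of sets of pairs and of sets of triples.\<close>

definition star1 :: "('x list set \<Rightarrow> 's list set) \<Rightarrow> 'x set \<Rightarrow> 's set" where
  "star1 star A = {a. [a] \<in> star {[x] | x. x \<in> A}}"

definition star2 :: "('x list set \<Rightarrow> 's list set) \<Rightarrow> ('x \<times> 'x) set \<Rightarrow> ('s \<times> 's) set" where
  "star2 star A = {(a, b). [a, b] \<in> star {[x, y] | x y. (x, y) \<in> A}}"

definition star3 ::
    "('x list set \<Rightarrow> 's list set) \<Rightarrow> ('x \<times> 'x \<times> 'x) set \<Rightarrow> ('s \<times> 's \<times> 's) set" where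
  "star3 star A = {(a, b, c). [a, b, c] \<in> star {[x, y, z] | x y z. (x, y, z) \<in> A}}"

text \<open>The monad of an ultrafilter \<open>u\<close> on \<open>X\<close>; \<open>st\<close> is \<open>star1 star\<close> if \<open>X\<close> is a set of elements
  of the universe and \<open>star2 star\<close> if it is a set of pairs.\<close>

definition monad :: "('a set \<Rightarrow> 'b set) \<Rightarrow> 'a set \<Rightarrow> 'a set set \<Rightarrow> 'b set" where
  "monad st X u = {\<alpha> \<in> st X. \<forall>A. A \<subseteq> X \<longrightarrow> (A \<in> u \<longleftrightarrow> \<alpha> \<in> st A)}"


section \<open>Ternary relations and their extensions to ultrafilters\<close>

definition e_transitive :: "'x set \<Rightarrow> 'x \<Rightarrow> ('x \<times> 'x \<times> 'x) set \<Rightarrow> bool" where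
  "e_transitive I e R \<longleftrightarrow>
     (\<forall>i\<in>I - {e}. \<forall>j\<in>I - {e}. \<forall>a\<in>I. \<forall>b\<in>I.
        (i, j, e) \<in> R \<and> (j, a, b) \<in> R \<longrightarrow> (i, a, b) \<in> R)"

definition e_reflexive :: "'x set \<Rightarrow> 'x \<Rightarrow> ('x \<times> 'x \<times> 'x) set \<Rightarrow> bool" where
  "e_reflexive I e R \<longleftrightarrow> (\<forall>i\<in>I - {e}. (i, i, e) \<in> R)"

text \<open>For \<open>R \<subseteq> (I - {e}) \<times> I \<times> I\<close> and \<open>p \<in> \<beta> I\<close> other than the principal ultrafilter on
  \<open>e\<close>, it makes no difference in the next two definitions whether \<open>p\<close> is regarded as an
  ultrafilter on \<open>I\<close> or on \<open>I - {e}\<close>; \<open>p\<close> is kept on \<open>I\<close>.\<close>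

definition strong_ext ::
    "'x set \<Rightarrow> ('x \<times> 'x \<times> 'x) set \<Rightarrow> 'x set set \<Rightarrow> 'x set set \<Rightarrow> 'x set set \<Rightarrow> bool" where
  "strong_ext I R p u v \<longleftrightarrow> {c\<in>I. {a\<in>I. {b\<in>I. (c, a, b) \<in> R} \<in> v} \<in> u} \<in> p"

definition mixed_ext ::
    "('x list set \<Rightarrow> 's list set) \<Rightarrow> 'x set \<Rightarrow> ('x \<times> 'x \<times> 'x) set \<Rightarrow>
     'x set set \<Rightarrow> 'x set set \<Rightarrow> 'x set set \<Rightarrow> bool" where
  "mixed_ext star I R p u v \<longleftrightarrow>
     (\<exists>\<gamma> \<in> monad (star1 star) I p.
      \<exists>(\<alpha>, \<delta>) \<in> monad (star2 star) (I \<times> I) (tensor I I u v).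
        (\<gamma>, \<alpha>, \<delta>) \<in> star3 star R)"

end

(* Saturation shows that R^m(p, u, v) holds iff for every A in p the set of all pairs (a, b) with
   R(c, a, b) for some c in A belongs to u \<otimes> v; in particular R^s is always contained in R^m.
   If p is a self-R(.,.,e) ultrafilter, apply this to A = {j. R(i, j, e)}, which is in p for
   p-almost all i: by e-transitivity R(i, a, b) holds for (u \<otimes> v)-almost all (a, b), which is
   R^s(p, u, v).  Conversely, e-reflexivity gives R^m(p, p, e), and R^s(p, p, e) says that p is a
   self-R(.,.,e) ultrafilter. *)

theory Submission
  imports Defs
begin

section \<open>Ultrafilters on a set and their tensor products\<close>

lemma ultrafilter_on_Int: "ultrafilter_on X u \<Longrightarrow> A \<in> u \<Longrightarrow> B \<in> u \<Longrightarrow> A \<inter> B \<in> u"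
  unfolding ultrafilter_on_def by blast

lemma ultrafilter_on_mono: "ultrafilter_on X u \<Longrightarrow> A \<in> u \<Longrightarrow> A \<subseteq> B \<Longrightarrow> B \<subseteq> X \<Longrightarrow> B \<in> u"
  unfolding ultrafilter_on_def by blast

lemma ultrafilter_on_Compl: "ultrafilter_on X u \<Longrightarrow> A \<subseteq> X \<Longrightarrow> A \<notin> u \<Longrightarrow> X - A \<in> u"
  unfolding ultrafilter_on_def by blast

lemma ultrafilter_on_subset: "ultrafilter_on X u \<Longrightarrow> A \<in> u \<Longrightarrow> A \<subseteq> X"
  by (auto simp only: ultrafilter_on_def)

lemma ultrafilter_on_space: "ultrafilter_on X u \<Longrightarrow> X \<in> u"
  by (simp only: ultrafilter_on_def)

lemma ultrafilter_on_nonempty: "ultrafilter_on X u \<Longrightarrow> A \<in> u \<Longrightarrow> A \<noteq> {}"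
  by (auto simp only: ultrafilter_on_def)

lemma ultrafilter_on_principal_uf: "x \<in> X \<Longrightarrow> ultrafilter_on X (principal_uf X x)"
  unfolding ultrafilter_on_def principal_uf_def by blast

text \<open>If \<open>X - {x}\<close> is not a member, every member contains \<open>x\<close>, since
  one avoiding \<open>x\<close> would lie below \<open>X - {x}\<close>; by maximality every subset
  containing \<open>x\<close> is then a member. This is what makes p-almost every index different
  from \<open>e\<close>.\<close>

lemma ultrafilter_on_Diff_singleton:
  assumes u: "ultrafilter_on X u" and ne: "u \<noteq> principal_uf X x"
  shows "X - {x} \<in> u"
proof (rule ccontr)
  assume *: "X - {x} \<notin> u"
  have mem: "x \<in> A" if "A \<in> u" for A
    using * that ultrafilter_on_mono[OF u that, of "X - {x}"] ultrafilter_on_subset[OF u that]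
    by blast
  have "A \<in> u" if "A \<subseteq> X" "x \<in> A" for A
    using mem[of "X - A"] ultrafilter_on_Compl[OF u that(1)] that(2) by blast
  then have "u = principal_uf X x"
    using mem ultrafilter_on_subset[OF u] unfolding principal_uf_def by blast
  with ne show False ..
qed

text \<open>Each axiom is verified first for \<open>v\<close> on the sections over a fixed
  \<open>i\<close>, then for \<open>u\<close> on the set of indices whose section is in
  \<open>v\<close>. For complements, maximality is applied at both levels.\<close>

lemma ultrafilter_on_tensor:
  assumes u: "ultrafilter_on X u" and v: "ultrafilter_on Y v"
  shows "ultrafilter_on (X \<times> Y) (tensor X Y u v)"
proof -
  let ?sec = "\<lambda>A i. {j \<in> Y. (i, j) \<in> A}"
  have space: "X \<times> Y \<in> tensor X Y u v"
  proof -
    have "?sec (X \<times> Y) i = Y" if "i \<in> X" for i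
      using that by blast
    then have "{i \<in> X. ?sec (X \<times> Y) i \<in> v} = X"
      using ultrafilter_on_space[OF v] by auto
    then show ?thesis
      using ultrafilter_on_space[OF u] by (simp add: tensor_def)
  qed
  have empty: "{} \<notin> tensor X Y u v"
    proof -
    have "{} \<notin> u" "{} \<notin> v"
      using ultrafilter_on_nonempty[OF u] ultrafilter_on_nonempty[OF v] by blast+
    then show ?thesis
      by (simp add: tensor_def)
  qed
  have int: "A \<inter> B \<in> tensor X Y u v" if A: "A \<in> tensor X Y u v" and B: "B \<in> tensor X Y u v" for A B
  proof -
    have "{i \<in> X. ?sec A i \<in> v} \<inter> {i \<in> X. ?sec B i \<in> v} \<in> u"
      using A B ultrafilter_on_Int[OF u] by (simp add: tensor_def)
    moreover have "?sec (A \<inter> B) i \<in> v" if "?sec A i \<in> v" "?sec B i \<in> v" for i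
    proof -
      have "?sec A i \<inter> ?sec B i \<in> v"
        using that by (rule ultrafilter_on_Int[OF v])
      also have "?sec A i \<inter> ?sec B i = ?sec (A \<inter> B) i"
        by blast
      finally show ?thesis .
    qed
    then have "{i \<in> X. ?sec A i \<in> v} \<inter> {i \<in> X. ?sec B i \<in> v} \<subseteq> {i \<in> X. ?sec (A \<inter> B) i \<in> v}"
      by blast
    ultimately have "{i \<in> X. ?sec (A \<inter> B) i \<in> v} \<in> u"
      by (rule ultrafilter_on_mono[OF u]) blast
    then show ?thesis
      using A by (auto simp: tensor_def)
  qed
  have mono: "B \<in> tensor X Y u v" if A: "A \<in> tensor X Y u v" and AB: "A \<subseteq> B" "B \<subseteq> X \<times> Y" for A B
  proof -
    have "?sec B i \<in> v" if "?sec A i \<in> v" for i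
      using that by (rule ultrafilter_on_mono[OF v]) (use AB in auto)
    then have sub: "{i \<in> X. ?sec A i \<in> v} \<subseteq> {i \<in> X. ?sec B i \<in> v}"
      by blast
    have "{i \<in> X. ?sec A i \<in> v} \<in> u"
      using A by (simp add: tensor_def)
    then have "{i \<in> X. ?sec B i \<in> v} \<in> u"
      using sub by (rule ultrafilter_on_mono[OF u]) blast
    then show ?thesis
      using AB by (simp add: tensor_def)
  qed
  have compl: "X \<times> Y - A \<in> tensor X Y u v" if A: "A \<subseteq> X \<times> Y" and nA: "A \<notin> tensor X Y u v" for A
  proof -
    have "X - {i \<in> X. ?sec A i \<in> v} \<in> u"
      using A nA ultrafilter_on_Compl[OF u, of "{i \<in> X. ?sec A i \<in> v}"] by (auto simp: tensor_def)
    moreover have "?sec (X \<times> Y - A) i \<in> v" if "i \<in> X" "?sec A i \<notin> v" for i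
    proof -
      have "Y - ?sec A i \<in> v"
        using that(2) by (intro ultrafilter_on_Compl[OF v]) auto
      also have "Y - ?sec A i = ?sec (X \<times> Y - A) i"
        using that(1) by blast
      finally show ?thesis .
    qed
    then have "X - {i \<in> X. ?sec A i \<in> v} \<subseteq> {i \<in> X. ?sec (X \<times> Y - A) i \<in> v}"
      by blast
    ultimately have "{i \<in> X. ?sec (X \<times> Y - A) i \<in> v} \<in> u"
      by (rule ultrafilter_on_mono[OF u]) blast
    then show ?thesis
      by (simp add: tensor_def)
  qed
  show ?thesis
    unfolding ultrafilter_on_def
  proof (intro conjI ballI allI impI)
    show "tensor X Y u v \<subseteq> Pow (X \<times> Y)"
      by (auto simp: tensor_def)
    show "A \<in> tensor X Y u v \<or> X \<times> Y - A \<in> tensor X Y u v" if "A \<subseteq> X \<times> Y" for A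
      using compl[OF that] by blast
    show "B \<in> tensor X Y u v" if "A \<in> tensor X Y u v" "A \<subseteq> B \<and> B \<subseteq> X \<times> Y" for A B
      using mono that by blast
  qed (fact space empty int)+
qed

section \<open>Consequences of the transfer principle\<close>

text \<open>A single formula is transferred, its free variables being read universally. Since the
  index lists may differ, one assignment expresses inclusions as well as coordinate
  projections.\<close>

lemma transfer_imp:
  fixes star :: "'x list set \<Rightarrow> 's list set" and "is" js ks :: "nat list" and \<nu> :: "nat \<Rightarrow> 's"
  assumes ext: "nonstandard_extension star"
    and std: "\<And>\<nu> :: nat \<Rightarrow> 'x. map \<nu> is \<in> A \<Longrightarrow> map \<nu> js \<in> B \<Longrightarrow> map \<nu> ks \<in> C"
    and "map \<nu> is \<in> star A" "map \<nu> js \<in> star B"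
  shows "map \<nu> ks \<in> star C"
proof -
  let ?\<phi> = "Neg (Conj (Rel A is) (Conj (Rel B js) (Neg (Rel C ks))))"
  have "\<forall>\<nu>. holds (\<lambda>A. A) \<nu> ?\<phi>"
    using std by auto
  then have "holds star \<nu> ?\<phi>"
    using ext unfolding nonstandard_extension_def by blast
  with assms(3,4) show ?thesis
    by simp
qed

lemma star_empty:
  assumes "nonstandard_extension star"
  shows "star {} = {}"
proof -
  have "xs \<notin> star {}" for xs
  proof -
    \<comment> \<open>Under the assignment \<open>nth xs\<close>, the variables from 0 to
      \<open>length xs - 1\<close> spell out \<open>xs\<close>, so a list of any length is reached
      by an atomic formula.\<close>
    let ?\<phi> = "Neg (Rel {} [0..<length xs])"
    have "\<forall>\<nu>. holds (\<lambda>A. A) \<nu> ?\<phi>"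
      by simp
    then have "holds star (nth xs) ?\<phi>"
      using assms unfolding nonstandard_extension_def by blast
    then show ?thesis
      by (simp add: map_nth)
  qed
  then show ?thesis
    by blast
qed

lemma star_Int_subset:
  assumes "nonstandard_extension star" "A \<inter> B \<subseteq> C"
  shows "star A \<inter> star B \<subseteq> star C"
proof
  fix xs
  assume "xs \<in> star A \<inter> star B"
  then have "map (nth xs) [0..<length xs] \<in> star A" "map (nth xs) [0..<length xs] \<in> star B"
    by (simp_all add: map_nth)
  then have "map (nth xs) [0..<length xs] \<in> star C"
    by (rule transfer_imp[OF assms(1), rotated]) (use assms(2) in blast)
  then show "xs \<in> star C"
    by (simp add: map_nth)
qed

lemma star_mono:
  assumes "nonstandard_extension star" "A \<subseteq> B"
  shows "star A \<subseteq> star B"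
  using star_Int_subset[OF assms(1), of A A B] assms(2) by blast

lemma star_disjoint:
  assumes "nonstandard_extension star" "A \<inter> B = {}"
  shows "star A \<inter> star B = {}"
  using star_Int_subset[OF assms(1), of A B "{}"] star_empty[OF assms(1)] assms(2) by blast

lemma star_nonempty:
  assumes ext: "nonstandard_extension star" and mem: "[x, y, z] \<in> A"
  shows "\<exists>x y z. [x, y, z] \<in> star A"
proof -
  let ?\<phi> = "Ex 0 (Ex 1 (Ex 2 (Rel A [0, 1, 2])))"
  have "\<forall>\<nu>. holds (\<lambda>A. A) \<nu> ?\<phi>"
    using mem by auto
  \<comment> \<open>The formula is closed, so any assignment serves.\<close>
  then have "holds star undefined ?\<phi>"
    using ext unfolding nonstandard_extension_def by blast
  then show ?thesis
    by auto
qed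

section \<open>Points of monads\<close>

text \<open>One half of the equivalence in \<open>monad\<close> implies the other: a subset of
  \<open>X\<close> outside \<open>u\<close> has its complement in \<open>u\<close>, and no point
  lies in the extensions of both. Keeping \<open>st\<close> abstract covers \<open>star1\<close> and
  \<open>star2\<close> together.\<close>

lemma monadI:
  assumes u: "ultrafilter_on X u"
    and disj: "\<And>A B. A \<inter> B = {} \<Longrightarrow> st A \<inter> st B = {}"
    and mem: "\<And>A. A \<in> u \<Longrightarrow> x \<in> st A"
  shows "x \<in> monad st X u"
proof -
  have "A \<in> u" if "A \<subseteq> X" "x \<in> st A" for A
    using that disj[of A "X - A"] mem[of "X - A"] ultrafilter_on_Compl[OF u] by blast
  then show ?thesis
    using mem ultrafilter_on_space[OF u] unfolding monad_def by blast
qed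

lemma star1_disjoint:
  assumes "nonstandard_extension star" "A \<inter> B = {}"
  shows "star1 star A \<inter> star1 star B = {}"
proof -
  have "{[x] |x. x \<in> A} \<inter> {[x] |x. x \<in> B} = {}"
    using assms(2) by blast
  from star_disjoint[OF assms(1) this] show ?thesis
    unfolding star1_def by blast
qed

lemma star2_disjoint:
  assumes "nonstandard_extension star" "A \<inter> B = {}"
  shows "star2 star A \<inter> star2 star B = {}"
proof -
  have "{[x, y] |x y. (x, y) \<in> A} \<inter> {[x, y] |x y. (x, y) \<in> B} = {}"
    using assms(2) by blast
  from star_disjoint[OF assms(1) this] show ?thesis
    unfolding star2_def by blast
qed

section \<open>Saturation and the mixed extension\<close>

text \<open>From left to right, the point in the monad of \<open>p\<close> witnesses, by transfer,
  that the pair lies in the extension of the image of \<open>A\<close> under \<open>R\<close>. From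
  right to left, the internal sets approximating the required triple have the finite intersection
  property, and saturation gives a common element.\<close>

lemma mixed_ext_iff:
  fixes I :: "'x set" and star :: "'x list set \<Rightarrow> 's list set" and \<kappa> :: "'k rel"
  assumes suff: "sufficiently_saturated_extension star I \<kappa>"
    and R: "R \<subseteq> I \<times> I \<times> I"
    and p: "ultrafilter_on I p" and u: "ultrafilter_on I u" and v: "ultrafilter_on I v"
  shows "mixed_ext star I R p u v \<longleftrightarrow>
    (\<forall>A\<in>p. {(a, b). \<exists>c\<in>A. (c, a, b) \<in> R} \<in> tensor I I u v)"
proof -
  note ext = suff[unfolded sufficiently_saturated_extension_def, THEN conjunct1]
  define w where "w = tensor I I u v"
  have w: "ultrafilter_on (I \<times> I) w"
    unfolding w_def using u v by (rule ultrafilter_on_tensor)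
  define img where "img A = {(a, b). \<exists>c\<in>A. (c, a, b) \<in> R}" for A
  have img_sub: "img A \<subseteq> I \<times> I" for A
    using R by (auto simp: img_def)
  have "mixed_ext star I R p u v \<longleftrightarrow> (\<forall>A\<in>p. img A \<in> w)"
  proof
    assume "mixed_ext star I R p u v"
    then obtain x y z where x: "x \<in> monad (star1 star) I p"
      and yz: "(y, z) \<in> monad (star2 star) (I \<times> I) w" and xyz: "(x, y, z) \<in> star3 star R"
      unfolding mixed_ext_def w_def by blast
    show "\<forall>A\<in>p. img A \<in> w"
    proof
      fix A
      assume A: "A \<in> p"
      \<comment> \<open>Variables 0, 1, 2 name the three coordinates, so \<open>[0]\<close> and
        \<open>[1, 2]\<close> pick out the point and the pair.\<close>
      let ?\<nu> = "nth [x, y, z]"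
      have "x \<in> star1 star A"
        using x A ultrafilter_on_subset[OF p A] unfolding monad_def by blast
      then have "map ?\<nu> [0] \<in> star {[c] |c. c \<in> A}"
        by (simp add: star1_def)
      moreover have "map ?\<nu> [0, 1, 2] \<in> star {[c, a, b] |c a b. (c, a, b) \<in> R}"
        using xyz by (simp add: star3_def)
      ultimately have "map ?\<nu> [1, 2] \<in> star {[a, b] |a b. (a, b) \<in> img A}"
        by (rule transfer_imp[OF ext, rotated]) (auto simp: img_def)
      then have "(y, z) \<in> star2 star (img A)"
        by (simp add: star2_def)
      \<comment> \<open>A pair in the monad of \<open>w\<close> decides, for each subset of
        \<open>I \<times> I\<close>, whether it belongs to \<open>w\<close>.\<close>
      then show "img A \<in> w"
        using yz img_sub[of A] unfolding monad_def by blast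
    qed
  next
    assume img: "\<forall>A\<in>p. img A \<in> w"
    \<comment> \<open>A triple in the extensions of all these sets meets the requirements of
      \<open>p\<close>, \<open>w\<close> and \<open>R\<close> at once.\<close>
    define cyl where "cyl A B = {[c, a, b] |c a b. c \<in> A \<and> (a, b) \<in> B \<and> (c, a, b) \<in> R}" for A B
    \<comment> \<open>The length condition gives the shape asked for by \<open>internal\<close>,
      with an empty list of parameters.\<close>
    define S where "S A B = {xs. length xs = 3 \<and> xs \<in> star (cyl A B)}" for A B
    define F where "F = {S A B |A B. A \<in> p \<and> B \<in> w}"
    have S_mono: "S A B \<subseteq> S A' B'" if "A \<subseteq> A'" "B \<subseteq> B'" for A A' B B'
    proof -
      have "cyl A B \<subseteq> cyl A' B'"
        using that by (auto simp: cyl_def)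
      from star_mono[OF ext this] show ?thesis
        by (auto simp: S_def)
    qed
    \<comment> \<open>By monotonicity the family is directed downwards, so every finite intersection
      contains a single \<open>S A B\<close>. This reduces the finite intersection property to
      non-emptiness of each \<open>S A B\<close>.\<close>
    have fip: "\<exists>A\<in>p. \<exists>B\<in>w. S A B \<subseteq> \<Inter>G" if "finite G" "G \<subseteq> F" for G
      using that
    proof (induction G rule: finite_induct)
      case empty
      show ?case
        using ultrafilter_on_space[OF p] ultrafilter_on_space[OF w] by auto
    next
      case (insert T G)
      then obtain A B where AB: "A \<in> p" "B \<in> w" "S A B \<subseteq> \<Inter>G"
        by auto
      from insert.prems obtain A' B' where AB': "A' \<in> p" "B' \<in> w" "T = S A' B'"
        unfolding F_def by blast
      have "S (A \<inter> A') (B \<inter> B') \<subseteq> \<Inter>(insert T G)"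
        using AB(3) AB'(3) S_mono[of "A \<inter> A'" A "B \<inter> B'" B] S_mono[of "A \<inter> A'" A' "B \<inter> B'" B']
        by blast
      then show ?case
        using ultrafilter_on_Int[OF p AB(1) AB'(1)] ultrafilter_on_Int[OF w AB(2) AB'(2)] by blast
    qed
    \<comment> \<open>The hypothesis enters here: \<open>img A\<close> and \<open>B\<close> are both
      in \<open>w\<close>, hence they meet, and a common pair extends to a standard triple in
      \<open>cyl A B\<close>. Its existence is then transferred.\<close>
    have S_ne: "S A B \<noteq> {}" if "A \<in> p" "B \<in> w" for A B
    proof -
      have "img A \<inter> B \<in> w"
        using img that ultrafilter_on_Int[OF w] by blast
      then obtain a b where "(a, b) \<in> img A \<inter> B"
        using ultrafilter_on_nonempty[OF w] by fast
      then obtain c where "[c, a, b] \<in> cyl A B"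
        by (auto simp: img_def cyl_def)
      then obtain x y z where "[x, y, z] \<in> star (cyl A B)"
        using star_nonempty[OF ext] by blast
      then have "[x, y, z] \<in> S A B"
        by (simp add: S_def)
      then show ?thesis
        by blast
    qed
    have "\<forall>T\<in>F. internal star 3 T"
    proof
      fix T
      assume "T \<in> F"
      then obtain A B where "T = {xs. length xs = 3 \<and> [] @ xs \<in> star (cyl A B)}"
        by (auto simp: F_def S_def)
      then show "internal star 3 T"
        unfolding internal_def by blast
    qed
    moreover have "|F| <o \<kappa>"
    proof -
      \<comment> \<open>Each \<open>S A B\<close> depends only on \<open>cyl A B\<close>, a set of
        triples over \<open>I\<close>, so \<open>F\<close> is no larger than the power set of the
        cube of \<open>I\<close>.\<close>
      let ?P = "Pow {xs. set xs \<subseteq> I \<and> length xs = 3}"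
      have "cyl A B \<in> ?P" for A B
        using R by (auto simp: cyl_def)
      then have "F \<subseteq> (\<lambda>C. {xs. length xs = 3 \<and> xs \<in> star C}) ` ?P"
        by (auto simp: F_def S_def)
      then have "|F| \<le>o |?P|"
        by (rule ordLeq_transitive[OF card_of_mono1 card_of_image])
      moreover have "|?P| <o \<kappa>"
        using suff unfolding sufficiently_saturated_extension_def powers_below_def by blast
      ultimately show ?thesis
        by (rule ordLeq_ordLess_trans)
    qed
    moreover have "\<forall>G. G \<subseteq> F \<and> finite G \<longrightarrow> \<Inter>G \<noteq> {}"
    proof (intro allI impI)
      fix G
      assume "G \<subseteq> F \<and> finite G"
      then obtain A B where "A \<in> p" "B \<in> w" "S A B \<subseteq> \<Inter>G"
        using fip by meson
      with S_ne[of A B] show "\<Inter>G \<noteq> {}"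
        by auto
    qed
    moreover have "saturated star \<kappa>"
      using suff by (simp add: sufficiently_saturated_extension_def)
    ultimately have "\<Inter>F \<noteq> {}"
      unfolding saturated_def by meson
    then obtain xs where xs: "\<And>A B. A \<in> p \<Longrightarrow> B \<in> w \<Longrightarrow> xs \<in> S A B"
      unfolding F_def by blast
    then have "length xs = 3"
      using ultrafilter_on_space[OF p] ultrafilter_on_space[OF w] unfolding S_def by blast
    then obtain x y z where xs_eq: "xs = [x, y, z]"
      by (auto simp: numeral_3_eq_3 length_Suc_conv)
    let ?\<nu> = "nth [x, y, z]"
    have cyl: "map ?\<nu> [0, 1, 2] \<in> star (cyl A B)" if "A \<in> p" "B \<in> w" for A B
      using xs[OF that] by (simp add: S_def xs_eq)
    have "x \<in> star1 star A" if "A \<in> p" for A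
    proof -
      \<comment> \<open>The second index is the whole space. A projection has one premise only, so
        the same fact fills both premises of \<open>transfer_imp\<close>.\<close>
      note mem = cyl[OF that ultrafilter_on_space[OF w]]
      have "map ?\<nu> [0] \<in> star {[c] |c. c \<in> A}"
        by (rule transfer_imp[OF ext _ mem mem]) (auto simp: cyl_def)
      then show ?thesis
        by (simp add: star1_def)
    qed
    with star1_disjoint[OF ext] have "x \<in> monad (star1 star) I p"
      by (rule monadI[OF p])
    moreover have "(y, z) \<in> star2 star B" if "B \<in> w" for B
    proof -
      note mem = cyl[OF ultrafilter_on_space[OF p] that]
      have "map ?\<nu> [1, 2] \<in> star {[a, b] |a b. (a, b) \<in> B}"
        by (rule transfer_imp[OF ext _ mem mem]) (auto simp: cyl_def)
      then show ?thesis
        by (simp add: star2_def)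
    qed
    with star2_disjoint[OF ext] have "(y, z) \<in> monad (star2 star) (I \<times> I) w"
      by (rule monadI[OF w])
    moreover have "(x, y, z) \<in> star3 star R"
    proof -
      note mem = cyl[OF ultrafilter_on_space[OF p] ultrafilter_on_space[OF w]]
      have "map ?\<nu> [0, 1, 2] \<in> star {[c, a, b] |c a b. (c, a, b) \<in> R}"
        by (rule transfer_imp[OF ext _ mem mem]) (auto simp: cyl_def)
      then show ?thesis
        by (simp add: star3_def)
    qed
    ultimately show "mixed_ext star I R p u v"
      unfolding mixed_ext_def w_def by blast
  qed
  then show ?thesis
    by (simp add: img_def w_def)
qed

section \<open>Comparison of the strong and the mixed extension\<close>

text \<open>The two inner quantifiers of \<open>strong_ext\<close> are those of
  \<open>tensor\<close>. Both extensions thereby become statements about tensor membership of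
  sections of \<open>R\<close>.\<close>

lemma strong_ext_iff:
  assumes "R \<subseteq> I \<times> I \<times> I"
  shows "strong_ext I R p u v \<longleftrightarrow> {c \<in> I. {(a, b). (c, a, b) \<in> R} \<in> tensor I I u v} \<in> p"
proof -
  have "{(a, b). (c, a, b) \<in> R} \<subseteq> I \<times> I" for c
    using assms by blast
  then show ?thesis
    by (simp add: strong_ext_def tensor_def)
qed

theorem mainTheorem2:
  fixes I :: "'x set" and e :: 'x and R :: "('x \<times> 'x \<times> 'x) set" and p :: "'x set set"
    and star :: "'x list set \<Rightarrow> 's list set" and \<kappa> :: "'k rel"
  assumes "sufficiently_saturated_extension star I \<kappa>"
    and "e \<in> I"
    and "R \<subseteq> (I - {e}) \<times> I \<times> I"
    and "e_transitive I e R"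
    and "e_reflexive I e R"
    and "p \<in> \<beta> I"
    and "p \<noteq> principal_uf I e"
  shows "{(u, v). u \<in> \<beta> I \<and> v \<in> \<beta> I \<and> mixed_ext star I R p u v} =
         {(u, v). u \<in> \<beta> I \<and> v \<in> \<beta> I \<and> strong_ext I R p u v}
         \<longleftrightarrow> self_ultrafilter I {(i, j). (i, j, e) \<in> R} p"
proof -
  have R: "R \<subseteq> I \<times> I \<times> I"
    using assms(3) by blast
  have p: "ultrafilter_on I p"
    using assms(6) by (simp add: \<beta>_def)
  have pe: "I - {e} \<in> p"
    using p assms(7) by (rule ultrafilter_on_Diff_singleton)
  have mixed: "mixed_ext star I R p u v \<longleftrightarrow>
      (\<forall>A\<in>p. {(a, b). \<exists>c\<in>A. (c, a, b) \<in> R} \<in> tensor I I u v)" if "u \<in> \<beta> I" "v \<in> \<beta> I" for u v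
    using that by (intro mixed_ext_iff[OF assms(1) R p]) (simp_all add: \<beta>_def)
  have tensor: "ultrafilter_on (I \<times> I) (tensor I I u v)" if "u \<in> \<beta> I" "v \<in> \<beta> I" for u v
    using that by (intro ultrafilter_on_tensor) (simp_all add: \<beta>_def)
  \<comment> \<open>Every \<open>A\<close> in \<open>p\<close> contains some \<open>c\<close> whose
    section is in the tensor product, and that section lies in the union of the sections over
    \<open>A\<close>.\<close>
  have strong_imp_mixed: "mixed_ext star I R p u v"
    if uv: "u \<in> \<beta> I" "v \<in> \<beta> I" and s: "strong_ext I R p u v" for u v
    unfolding mixed[OF uv]
  proof
    fix A
    assume "A \<in> p"
    then have "A \<inter> {c \<in> I. {(a, b). (c, a, b) \<in> R} \<in> tensor I I u v} \<in> p"
      using s ultrafilter_on_Int[OF p] by (simp add: strong_ext_iff[OF R])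
    then obtain c where "c \<in> A" and c: "{(a, b). (c, a, b) \<in> R} \<in> tensor I I u v"
      using ultrafilter_on_nonempty[OF p] by fast
    from c show "{(a, b). \<exists>c\<in>A. (c, a, b) \<in> R} \<in> tensor I I u v"
      by (rule ultrafilter_on_mono[OF tensor[OF uv]]) (use R \<open>c \<in> A\<close> in auto)
  qed
  show ?thesis
  proof
    assume eq: "{(u, v). u \<in> \<beta> I \<and> v \<in> \<beta> I \<and> mixed_ext star I R p u v} =
         {(u, v). u \<in> \<beta> I \<and> v \<in> \<beta> I \<and> strong_ext I R p u v}"
    \<comment> \<open>Against this ultrafilter the condition on \<open>b\<close> collapses to
      \<open>b = e\<close>, leaving the binary relation of the self-ultrafilter condition.\<close>
    let ?v = "principal_uf I e"
    have v: "?v \<in> \<beta> I"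
      using assms(2) by (simp add: \<beta>_def ultrafilter_on_principal_uf)
    have "mixed_ext star I R p p ?v"
      unfolding mixed[OF assms(6) v]
    proof
      fix A
      assume "A \<in> p"
      \<comment> \<open>By e-reflexivity each \<open>a\<close> in this set is its own witness
        \<open>c\<close>.\<close>
      then have "A \<inter> (I - {e}) \<in> p"
        using pe ultrafilter_on_Int[OF p] by blast
      then have "{a \<in> I. \<exists>c\<in>A. (c, a, e) \<in> R} \<in> p"
        by (rule ultrafilter_on_mono[OF p]) (use assms(5) in \<open>auto simp: e_reflexive_def\<close>)
      moreover have "{(a, b). \<exists>c\<in>A. (c, a, b) \<in> R} \<subseteq> I \<times> I"
        using R by blast
      ultimately show "{(a, b). \<exists>c\<in>A. (c, a, b) \<in> R} \<in> tensor I I p ?v"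
        using assms(2) by (simp add: tensor_def principal_uf_def)
    qed
    then have "strong_ext I R p p ?v"
      using eq assms(6) v by blast
    then show "self_ultrafilter I {(i, j). (i, j, e) \<in> R} p"
      using assms(2) by (simp add: strong_ext_def self_ultrafilter_def principal_uf_def)
  next
    assume self: "self_ultrafilter I {(i, j). (i, j, e) \<in> R} p"
    have "strong_ext I R p u v"
      if uv: "u \<in> \<beta> I" "v \<in> \<beta> I" and m: "mixed_ext star I R p u v" for u v
      unfolding strong_ext_iff[OF R]
    proof (rule ultrafilter_on_mono[OF p])
      \<comment> \<open>Intersecting with \<open>I - {e}\<close> makes \<open>i\<close> admissible
        for e-transitivity.\<close>
      show "{i \<in> I. {j \<in> I. (i, j, e) \<in> R} \<in> p} \<inter> (I - {e}) \<in> p"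
        using self pe ultrafilter_on_Int[OF p] by (simp add: self_ultrafilter_def)
      show "{i \<in> I. {j \<in> I. (i, j, e) \<in> R} \<in> p} \<inter> (I - {e})
          \<subseteq> {c \<in> I. {(a, b). (c, a, b) \<in> R} \<in> tensor I I u v}"
      proof
        fix i
        assume "i \<in> {i \<in> I. {j \<in> I. (i, j, e) \<in> R} \<in> p} \<inter> (I - {e})"
        then have i: "i \<in> I - {e}" and A: "{j \<in> I. (i, j, e) \<in> R} \<in> p"
          by auto
        from m A have "{(a, b). \<exists>c\<in>{j \<in> I. (i, j, e) \<in> R}. (c, a, b) \<in> R} \<in> tensor I I u v"
          unfolding mixed[OF uv] by blast
        \<comment> \<open>Apply e-transitivity with \<open>c\<close> as the intermediate index;
          \<open>c\<close> differs from \<open>e\<close> because it is the first coordinate of a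
          triple in \<open>R\<close>.\<close>
        moreover have "{(a, b). \<exists>c\<in>{j \<in> I. (i, j, e) \<in> R}. (c, a, b) \<in> R}
            \<subseteq> {(a, b). (i, a, b) \<in> R}"
          using assms(3,4) i unfolding e_transitive_def by blast
        ultimately have "{(a, b). (i, a, b) \<in> R} \<in> tensor I I u v"
          by (rule ultrafilter_on_mono[OF tensor[OF uv]]) (use R in blast)
        with i show "i \<in> {c \<in> I. {(a, b). (c, a, b) \<in> R} \<in> tensor I I u v}"
          by blast
      qed
    qed blast
    then show "{(u, v). u \<in> \<beta> I \<and> v \<in> \<beta> I \<and> mixed_ext star I R p u v} =
         {(u, v). u \<in> \<beta> I \<and> v \<in> \<beta> I \<and> strong_ext I R p u v}"
      using strong_imp_mixed by blast
  qed
qed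

end
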